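(* Let $\mathcal{L}=(L,\vee,\wedge)$ be a finite distributive lattice, let $\mu:L\to\mathbb{R}_{>0}$ be a strictly positive log-supermodular function, i.e. $\mu(x)\mu(y)\le\mu(x\vee y)\mu(x\wedge y)$ for all $x,y\in L$, and let $f,g:L\to\mathbb{R}$ be increasing functions. Then $$\sum_{x\in L}f(x)\mu(x)\cdot\sum_{x\in L}g(x)\mu(x)\ =\ \sum_{x\in L}f(x)g(x)\mu(x)\cdot\sum_{x\in L}\mu(x)$$ if and only if $\mathcal{L}\simeq\mathcal{L}_1\times\mathcal{L}_2$ for some distributive lattices $\mathcal{L}_1=(L_1,\vee',\wedge')$ and $\mathcal{L}_2=(L_2,\vee'',\wedge'')$ such that, identifying $L$ with $L_1\times L_2$ via the isomorphism, $$f(x_1,x_2)=f'(x_1)\quad\text{and}\quad g(x_1,x_2)=g'(x_2)\qquad\text{for all }(x_1,x_2)\in L_1\times L_2,$$ and $$\mu(x_1,x_2)=\mu_1(x_1)\,\mu_2(x_2)\qquad\text{for all }(x_1,x_2)\in L_1\times L_2,$$ for some functions $f':L_1\to\mathbb{R}$, $g':L_2\to\mathbb{R}$, $\mu_1:L_1\to\mathbb{R}_{>0}$ and $\mu_2:L_2\to\mathbb{R}_{>0}$.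
   Context: The partial order on a lattice is $x\preccurlyeq y\iff x\vee y=y$. A function $f:L\to\mathbb{R}$ is increasing if $f(x)\le f(y)$ whenever $x\preccurlyeq y$. The direct product of two lattices has coordinatewise join and meet; one of the factors may be the trivial one-element lattice. *)

theory Defs
  imports Complex_Main "HOL-Algebra.Lattice"
begin

text \<open>
  Lattices are the carrier-based ones of HOL-Algebra. There the order is the primitive notion and
  join and meet are derived from it; the equivalence of \<open>x \<sqsubseteq> y\<close> with \<open>x \<squnion> y = y\<close>
  is the library lemma \<open>lattice.le_iff_meet\<close>.
\<close>

locale distributive_lattice = lattice +
  assumes meet_join_distrib:
    "\<lbrakk>x \<in> carrier L; y \<in> carrier L; z \<in> carrier L\<rbrakk>
      \<Longrightarrow> x \<sqinter> (y \<squnion> z) = (x \<sqinter> y) \<squnion> (x \<sqinter> z)"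

definition log_supermodular :: "'a gorder \<Rightarrow> ('a \<Rightarrow> real) \<Rightarrow> bool" where
  "log_supermodular L \<mu> \<longleftrightarrow>
    (\<forall>x \<in> carrier L. \<forall>y \<in> carrier L. \<mu> x * \<mu> y \<le> \<mu> (x \<squnion>\<^bsub>L\<^esub> y) * \<mu> (x \<sqinter>\<^bsub>L\<^esub> y))"

text \<open>
  Since the order is primitive, the direct product is given by the componentwise order. The lemmas
  \<open>lattice_direct_product\<close>, \<open>join_direct_product\<close> and \<open>meet_direct_product\<close>
  below show that this is the lattice with coordinatewise join and meet.
\<close>

definition direct_product :: "'a gorder \<Rightarrow> 'b gorder \<Rightarrow> ('a \<times> 'b) gorder" where
  "direct_product L1 L2 =
    \<lparr> carrier = carrier L1 \<times> carrier L2,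
      eq = (=),
      le = (\<lambda>x y. fst x \<sqsubseteq>\<^bsub>L1\<^esub> fst y \<and> snd x \<sqsubseteq>\<^bsub>L2\<^esub> snd y) \<rparr>"

definition lattice_isomorphism :: "'a gorder \<Rightarrow> 'b gorder \<Rightarrow> ('a \<Rightarrow> 'b) \<Rightarrow> bool" where
  "lattice_isomorphism X Y \<phi> \<longleftrightarrow>
    bij_betw \<phi> (carrier X) (carrier Y) \<and> join_pres X Y \<phi> \<and> meet_pres X Y \<phi>"

text \<open>
  \<open>L\<close> is isomorphic to the direct product of \<open>L1\<close> and \<open>L2\<close> in such a way that, identifying
  \<open>L\<close> with the product through \<open>\<phi>\<close>, \<open>f\<close> depends on the first coordinate only, \<open>g\<close> on the
  second coordinate only, and \<open>\<mu>\<close> is a product of positive functions of the coordinates.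

  HOL cannot quantify existentially over types, so "for some \<open>L1\<close> and \<open>L2\<close>" has to fix the
  types of the factors. Taking the type of \<open>L\<close> for both loses nothing, as the factors of a
  non-empty lattice embed into it (and an empty \<open>L\<close>, which the library admits, is the product
  of itself with itself). The converse implication is meaningful for factors over any types.
\<close>

definition splits_as_product ::
    "'a gorder \<Rightarrow> ('a \<Rightarrow> real) \<Rightarrow> ('a \<Rightarrow> real) \<Rightarrow> ('a \<Rightarrow> real) \<Rightarrow> 'b gorder \<Rightarrow> 'c gorder \<Rightarrow> bool" where
  "splits_as_product L \<mu> f g L1 L2 \<longleftrightarrow>
    distributive_lattice L1 \<and> distributive_lattice L2 \<and>
    (\<exists>\<phi>. lattice_isomorphism (direct_product L1 L2) L \<phi> \<and>
      (\<exists>f' g' \<mu>1 \<mu>2.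
        (\<forall>x1 \<in> carrier L1. \<mu>1 x1 > 0) \<and>
        (\<forall>x2 \<in> carrier L2. \<mu>2 x2 > 0) \<and>
        (\<forall>x1 \<in> carrier L1. \<forall>x2 \<in> carrier L2.
          f (\<phi> (x1, x2)) = f' x1 \<and>
          g (\<phi> (x1, x2)) = g' x2 \<and>
          \<mu> (\<phi> (x1, x2)) = \<mu>1 x1 * \<mu>2 x2)))"

lemma partial_order_direct_product:
  assumes "partial_order L1" "partial_order L2"
  shows "partial_order (direct_product L1 L2)"
proof -
  interpret A: partial_order L1 by fact
  interpret B: partial_order L2 by fact
  show ?thesis
    by unfold_locales
      (auto simp: direct_product_def intro: A.le_antisym B.le_antisym A.le_trans B.le_trans)
qed

lemma least_direct_product:
  assumes "lattice L1" "lattice L2" "a \<in> carrier L1" "b \<in> carrier L2" "c \<in> carrier L1" "d \<in> carrier L2"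
  shows "least (direct_product L1 L2) (a \<squnion>\<^bsub>L1\<^esub> c, b \<squnion>\<^bsub>L2\<^esub> d)
    (Upper (direct_product L1 L2) {(a, b), (c, d)})"
proof -
  interpret A: lattice L1 by fact
  interpret B: lattice L2 by fact
  show ?thesis
    using assms by (auto simp: direct_product_def least_def Upper_def
        intro: A.join_left B.join_left A.join_right B.join_right A.join_le B.join_le)
qed

lemma greatest_direct_product:
  assumes "lattice L1" "lattice L2" "a \<in> carrier L1" "b \<in> carrier L2" "c \<in> carrier L1" "d \<in> carrier L2"
  shows "greatest (direct_product L1 L2) (a \<sqinter>\<^bsub>L1\<^esub> c, b \<sqinter>\<^bsub>L2\<^esub> d)
    (Lower (direct_product L1 L2) {(a, b), (c, d)})"
proof -
  interpret A: lattice L1 by fact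
  interpret B: lattice L2 by fact
  show ?thesis
    using assms by (auto simp: direct_product_def greatest_def Lower_def
        intro: A.meet_left B.meet_left A.meet_right B.meet_right A.meet_le B.meet_le)
qed

lemma lattice_direct_product:
  assumes "lattice L1" "lattice L2"
  shows "lattice (direct_product L1 L2)"
proof -
  interpret A: lattice L1 by fact
  interpret B: lattice L2 by fact
  interpret P: partial_order "direct_product L1 L2"
    by (rule partial_order_direct_product) unfold_locales
  have c: "carrier (direct_product L1 L2) = carrier L1 \<times> carrier L2"
    by (simp add: direct_product_def)
  show ?thesis
  proof
    fix x y assume "x \<in> carrier (direct_product L1 L2)" "y \<in> carrier (direct_product L1 L2)"
    then obtain a b a' b' where "x = (a, b)" "y = (a', b')"
      "a \<in> carrier L1" "b \<in> carrier L2" "a' \<in> carrier L1" "b' \<in> carrier L2"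
      by (auto simp: c)
    then show "\<exists>s. least (direct_product L1 L2) s (Upper (direct_product L1 L2) {x, y})"
      and "\<exists>s. greatest (direct_product L1 L2) s (Lower (direct_product L1 L2) {x, y})"
      using least_direct_product[OF assms] greatest_direct_product[OF assms] by blast+
  qed
qed

lemma join_direct_product:
  assumes "lattice L1" "lattice L2" "a \<in> carrier L1" "b \<in> carrier L2" "c \<in> carrier L1" "d \<in> carrier L2"
  shows "(a, b) \<squnion>\<^bsub>direct_product L1 L2\<^esub> (c, d) = (a \<squnion>\<^bsub>L1\<^esub> c, b \<squnion>\<^bsub>L2\<^esub> d)"
proof -
  interpret P: lattice "direct_product L1 L2"
    by (rule lattice_direct_product) fact+
  show ?thesis
    unfolding join_def[of "direct_product L1 L2"] sup_def
    using least_direct_product[OF assms] by (blast intro: P.least_unique someI2)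
qed

lemma meet_direct_product:
  assumes "lattice L1" "lattice L2" "a \<in> carrier L1" "b \<in> carrier L2" "c \<in> carrier L1" "d \<in> carrier L2"
  shows "(a, b) \<sqinter>\<^bsub>direct_product L1 L2\<^esub> (c, d) = (a \<sqinter>\<^bsub>L1\<^esub> c, b \<sqinter>\<^bsub>L2\<^esub> d)"
proof -
  interpret P: lattice "direct_product L1 L2"
    by (rule lattice_direct_product) fact+
  show ?thesis
    unfolding meet_def[of "direct_product L1 L2"] inf_def
    using greatest_direct_product[OF assms] by (blast intro: P.greatest_unique someI2)
qed

end

theory Submission
  imports Defs
begin

text \<open>
  The difference of the two sides is the covariance of \<open>f\<close> and \<open>g\<close> under \<open>\<mu>\<close>, up to
  normalisation and sign. If \<open>L\<close> splits, it vanishes because all four sums factor.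

  For the converse, Birkhoff's representation turns \<open>L\<close> into a family \<open>\<X>\<close> of finite sets closed
  under union and intersection, so that a random element of \<open>L\<close> becomes a random set. For a point
  \<open>p\<close> the sets containing \<open>p\<close> and the sets avoiding \<open>p\<close> are again such families, and the law of
  total covariance writes the covariance of \<open>f\<close> and \<open>g\<close> as a positive combination of the two
  conditional covariances and of the product
  \<open>cov f 1\<^sub>p \<cdot> cov g 1\<^sub>p\<close>, where \<open>1\<^sub>p\<close> is the indicator of containing \<open>p\<close>. By the FKG inequality
  each of these terms is non-negative. So if \<open>f\<close> and \<open>g\<close> are uncorrelated, then they stay
  uncorrelated after conditioning on the presence or absence of any points, and every \<open>1\<^sub>p\<close> is
  uncorrelated with \<open>f\<close> or with \<open>g\<close> (\<open>cov_slices_eq_0\<close>).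

  Let \<open>A\<close> be the set of points whose indicator is correlated with \<open>f\<close>. Points outside \<open>A\<close> are
  uncorrelated with \<open>f\<close> and points in \<open>A\<close> are uncorrelated with \<open>g\<close>. For \<open>p \<in> A\<close> and \<open>q \<notin> A\<close>,
  the same dichotomy, applied to the uncorrelated pair \<open>f\<close>, \<open>1\<^sub>q\<close> and to the point \<open>p\<close>, shows that
  \<open>1\<^sub>p\<close> and \<open>1\<^sub>q\<close> are uncorrelated. Since this survives conditioning, pairwise
  independence of points across \<open>A\<close> upgrades to independence of the traces of the random set on
  \<open>A\<close> and on its complement. As \<open>\<mu>\<close> is positive on \<open>\<X>\<close>, this makes both \<open>\<X>\<close> and \<open>\<mu>\<close> a product
  (\<open>exchange\<close>). That \<open>f\<close> sees only the trace on \<open>A\<close>, and \<open>g\<close> only the trace on the complement, is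
  read off by conditioning down to families of two nested sets (\<open>depends_on\<close>).
\<close>

section \<open>The four functions theorem\<close>

text \<open>
  The four functions theorem for the subsets of a one-element set, hence the inductive step of the
  general one. The products \<open>u = a0 * b1\<close> and \<open>v = a1 * b0\<close> are both bounded by \<open>m = c1 * d0\<close>,
  and \<open>u * v \<le> m * (c0 * d1)\<close>; then \<open>(m - u) * (m - v) \<ge> 0\<close> gives \<open>u + v \<le> m + c0 * d1\<close>.
\<close>

lemma four_numbers:
  fixes a0 a1 b0 b1 c0 c1 d0 d1 :: real
  assumes nn: "a0 \<ge> 0" "a1 \<ge> 0" "b0 \<ge> 0" "b1 \<ge> 0" "c0 \<ge> 0" "c1 \<ge> 0" "d0 \<ge> 0" "d1 \<ge> 0"
    and "a0 * b0 \<le> c0 * d0" "a0 * b1 \<le> c1 * d0" "a1 * b0 \<le> c1 * d0" "a1 * b1 \<le> c1 * d1"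
  shows "(a0 + a1) * (b0 + b1) \<le> (c0 + c1) * (d0 + d1)"
proof -
  define m u v where "m = c1 * d0" and "u = a0 * b1" and "v = a1 * b0"
  have u: "0 \<le> u" "u \<le> m" and v: "0 \<le> v" "v \<le> m"
    using assms by (simp_all add: m_def u_def v_def)
  have "u + v \<le> m + c0 * d1"
  proof (cases "m = 0")
    case True
    then show ?thesis using u v nn by simp
  next
    case False
    then have m: "m > 0" using u by linarith
    have "u * v = (a0 * b0) * (a1 * b1)"
      by (simp add: u_def v_def)
    also have "\<dots> \<le> (c0 * d0) * (c1 * d1)"
      using assms by (intro mult_mono[of "a0 * b0" _ "a1 * b1"] mult_nonneg_nonneg) auto
    also have "\<dots> = m * (c0 * d1)"
      by (simp add: m_def)
    finally have "u * v \<le> m * (c0 * d1)" .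
    moreover have "0 \<le> (m - u) * (m - v)"
      using u v by simp
    ultimately have "m * (u + v) \<le> m * (m + c0 * d1)"
      by (simp add: algebra_simps)
    then show ?thesis using m by simp
  qed
  then show ?thesis
    using assms(9,12) by (simp add: m_def u_def v_def algebra_simps)
qed

lemma sum_Pow_insert:
  fixes h :: "'a set \<Rightarrow> real"
  assumes "finite P" "p \<notin> P"
  shows "sum h (Pow (insert p P)) = (\<Sum>x\<in>Pow P. h x + h (insert p x))"
proof -
  have "inj_on (insert p) (Pow P)"
    using assms(2) by (auto intro!: inj_onI)
  moreover have "Pow P \<inter> insert p ` Pow P = {}"
    using assms(2) by blast
  ultimately show ?thesis
    using assms(1) by (simp add: Pow_insert sum.union_disjoint sum.reindex sum.distrib)
qed

text \<open>
  Due to Ahlswede and Daykin. Summing all four functions over the presence or absence of one point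
  preserves the hypothesis by \<open>four_numbers\<close>, which removes that point from \<open>P\<close>.
\<close>

theorem four_functions:
  fixes \<alpha> \<beta> \<gamma> \<delta> :: "'a set \<Rightarrow> real"
  assumes "finite P"
    and "\<And>x. x \<subseteq> P \<Longrightarrow> 0 \<le> \<alpha> x \<and> 0 \<le> \<beta> x \<and> 0 \<le> \<gamma> x \<and> 0 \<le> \<delta> x"
    and "\<And>x y. x \<subseteq> P \<Longrightarrow> y \<subseteq> P \<Longrightarrow> \<alpha> x * \<beta> y \<le> \<gamma> (x \<union> y) * \<delta> (x \<inter> y)"
  shows "sum \<alpha> (Pow P) * sum \<beta> (Pow P) \<le> sum \<gamma> (Pow P) * sum \<delta> (Pow P)"
  using assms
proof (induction P arbitrary: \<alpha> \<beta> \<gamma> \<delta> rule: finite_induct)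
  case empty
  then show ?case using empty(2)[of "{}" "{}"] by simp
next
  case (insert p P)
  define \<alpha>' \<beta>' \<gamma>' \<delta>' where
    "\<alpha>' = (\<lambda>x. \<alpha> x + \<alpha> (insert p x))" "\<beta>' = (\<lambda>x. \<beta> x + \<beta> (insert p x))"
    "\<gamma>' = (\<lambda>x. \<gamma> x + \<gamma> (insert p x))" "\<delta>' = (\<lambda>x. \<delta> x + \<delta> (insert p x))"
  note defs = this
  have "sum \<alpha>' (Pow P) * sum \<beta>' (Pow P) \<le> sum \<gamma>' (Pow P) * sum \<delta>' (Pow P)"
  proof (rule insert.IH)
    fix x assume "x \<subseteq> P"
    then have "x \<subseteq> insert p P" "insert p x \<subseteq> insert p P" by auto
    from this[THEN insert.prems(1)]
    show "0 \<le> \<alpha>' x \<and> 0 \<le> \<beta>' x \<and> 0 \<le> \<gamma>' x \<and> 0 \<le> \<delta>' x"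
      unfolding defs by simp
  next
    fix x y assume xy: "x \<subseteq> P" "y \<subseteq> P"
    then have sub: "x \<subseteq> insert p P" "insert p x \<subseteq> insert p P" "y \<subseteq> insert p P" "insert p y \<subseteq> insert p P"
      "x \<union> y \<subseteq> insert p P" "insert p (x \<union> y) \<subseteq> insert p P"
      "x \<inter> y \<subseteq> insert p P" "insert p (x \<inter> y) \<subseteq> insert p P" by auto
    have "p \<notin> x" "p \<notin> y" using xy insert.hyps by auto
    then have eqs: "x \<inter> insert p y = x \<inter> y" "insert p x \<inter> y = x \<inter> y"
      "insert p x \<inter> insert p y = insert p (x \<inter> y)"
      "x \<union> insert p y = insert p (x \<union> y)" "insert p x \<union> y = insert p (x \<union> y)"
      "insert p x \<union> insert p y = insert p (x \<union> y)"
      by auto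
    note nn = sub[THEN insert.prems(1)]
    show "\<alpha>' x * \<beta>' y \<le> \<gamma>' (x \<union> y) * \<delta>' (x \<inter> y)"
      unfolding defs
      using nn insert.prems(2)[OF sub(1) sub(3)] insert.prems(2)[OF sub(1) sub(4)]
        insert.prems(2)[OF sub(2) sub(3)] insert.prems(2)[OF sub(2) sub(4)]
      unfolding eqs by (intro four_numbers) auto
  qed
  then show ?case
    using insert.hyps by (simp add: sum_Pow_insert defs)
qed

section \<open>Covariance and the FKG inequality\<close>

text \<open>
  Multiplying out the total mass avoids division: this is the covariance under the normalised
  weight, times \<open>(sum \<mu> \<X>)\<^sup>2\<close>. It also makes the empty family harmless, with covariance \<open>0\<close>.
\<close>

definition cov :: "'i set \<Rightarrow> ('i \<Rightarrow> real) \<Rightarrow> ('i \<Rightarrow> real) \<Rightarrow> ('i \<Rightarrow> real) \<Rightarrow> real" where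
  "cov \<X> \<mu> f g = (\<Sum>x\<in>\<X>. f x * g x * \<mu> x) * sum \<mu> \<X> - (\<Sum>x\<in>\<X>. f x * \<mu> x) * (\<Sum>x\<in>\<X>. g x * \<mu> x)"

lemma cov_commute: "cov \<X> \<mu> f g = cov \<X> \<mu> g f"
  by (simp add: cov_def mult.commute[of "f _" "g _"])

lemma cov_add_const: "cov \<X> \<mu> (\<lambda>x. f x + c) (\<lambda>x. g x + d) = cov \<X> \<mu> f g"
proof -
  have "(\<Sum>x\<in>\<X>. (f x + c) * (g x + d) * \<mu> x) =
    (\<Sum>x\<in>\<X>. f x * g x * \<mu> x) + d * (\<Sum>x\<in>\<X>. f x * \<mu> x) + c * (\<Sum>x\<in>\<X>. g x * \<mu> x) + c * d * sum \<mu> \<X>"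
    by (simp add: sum_distrib_left flip: sum.distrib) (simp add: algebra_simps)
  moreover have "(\<Sum>x\<in>\<X>. (f x + c) * \<mu> x) = (\<Sum>x\<in>\<X>. f x * \<mu> x) + c * sum \<mu> \<X>"
    "(\<Sum>x\<in>\<X>. (g x + d) * \<mu> x) = (\<Sum>x\<in>\<X>. g x * \<mu> x) + d * sum \<mu> \<X>"
    by (simp_all add: sum_distrib_left algebra_simps sum.distrib)
  ultimately show ?thesis
    by (simp add: cov_def algebra_simps)
qed

definition slice :: "'p set set \<Rightarrow> 'p \<Rightarrow> bool \<Rightarrow> 'p set set" where
  "slice \<X> p b = {x \<in> \<X>. (p \<in> x) = b}"

lemma slice_subset: "slice \<X> p b \<subseteq> \<X>"
  by (auto simp: slice_def)

lemma slice_commute: "slice (slice \<X> p b) q c = slice (slice \<X> q c) p b"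
  by (auto simp: slice_def)

lemma finite_slice: "finite \<X> \<Longrightarrow> finite (slice \<X> p b)"
  by (simp add: slice_def)

text \<open>
  Elements are sets, so that conditioning on a point again yields a family of the same kind.
\<close>

locale fkg_family =
  fixes \<X> :: "'p set set" and \<mu> :: "'p set \<Rightarrow> real"
  assumes finite_family: "finite \<X>"
    and finite_member: "x \<in> \<X> \<Longrightarrow> finite x"
    and Un_closed: "x \<in> \<X> \<Longrightarrow> y \<in> \<X> \<Longrightarrow> x \<union> y \<in> \<X>"
    and Int_closed: "x \<in> \<X> \<Longrightarrow> y \<in> \<X> \<Longrightarrow> x \<inter> y \<in> \<X>"
    and pos: "x \<in> \<X> \<Longrightarrow> \<mu> x > 0"
    and supermodular: "x \<in> \<X> \<Longrightarrow> y \<in> \<X> \<Longrightarrow> \<mu> x * \<mu> y \<le> \<mu> (x \<union> y) * \<mu> (x \<inter> y)"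
begin

lemma sum_eq_0_iff: "\<Y> \<subseteq> \<X> \<Longrightarrow> sum \<mu> \<Y> = 0 \<longleftrightarrow> \<Y> = {}"
  using finite_family pos sum_pos[of \<Y> \<mu>] finite_subset[of \<Y> \<X>] by fastforce

text \<open>
  Covariance is unchanged by adding constants, so \<open>f\<close> and \<open>g\<close> may be shifted to be non-negative.
  With all functions extended by \<open>0\<close> outside of \<open>\<X>\<close>, the inequality is the four functions theorem
  for \<open>f \<mu>\<close>, \<open>g \<mu>\<close>, \<open>f g \<mu>\<close> and \<open>\<mu>\<close>.
\<close>

theorem fkg:
  assumes f: "monotone_on \<X> (\<subseteq>) (\<le>) f" and g: "monotone_on \<X> (\<subseteq>) (\<le>) g"
  shows "cov \<X> \<mu> f g \<ge> 0"
proof -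
  have shift: "\<exists>c. \<forall>x\<in>\<X>. 0 \<le> h x + c" for h :: "'p set \<Rightarrow> real"
    using finite_family by (intro exI[of _ "- Min (h ` \<X>)"]) simp
  obtain c d where c: "\<And>x. x \<in> \<X> \<Longrightarrow> 0 \<le> f x + c" and d: "\<And>x. x \<in> \<X> \<Longrightarrow> 0 \<le> g x + d"
    using shift[of f] shift[of g] by blast
  define F G where "F = (\<lambda>x. f x + c)" and "G = (\<lambda>x. g x + d)"
  have F: "0 \<le> F x" and G: "0 \<le> G x" if "x \<in> \<X>" for x
    using c d that by (simp_all add: F_def G_def)
  have F_mono: "F x \<le> F y" and G_mono: "G x \<le> G y" if "x \<in> \<X>" "y \<in> \<X>" "x \<subseteq> y" for x y
    using monotone_onD[OF f that] monotone_onD[OF g that] by (simp_all add: F_def G_def)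
  define ext :: "('p set \<Rightarrow> real) \<Rightarrow> 'p set \<Rightarrow> real" where "ext = (\<lambda>h x. if x \<in> \<X> then h x else 0)"
  let ?P = "\<Union>\<X>"
  have P: "finite ?P"
    using finite_family finite_member by blast
  have sum_ext: "sum (ext h) (Pow ?P) = sum h \<X>" for h
    using P by (intro sum.mono_neutral_cong_right) (auto simp: ext_def)
  have "sum (ext (\<lambda>x. F x * \<mu> x)) (Pow ?P) * sum (ext (\<lambda>x. G x * \<mu> x)) (Pow ?P)
      \<le> sum (ext (\<lambda>x. F x * G x * \<mu> x)) (Pow ?P) * sum (ext \<mu>) (Pow ?P)"
  proof (rule four_functions[OF P])
    fix x
    show "0 \<le> ext (\<lambda>x. F x * \<mu> x) x \<and> 0 \<le> ext (\<lambda>x. G x * \<mu> x) x \<and>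
      0 \<le> ext (\<lambda>x. F x * G x * \<mu> x) x \<and> 0 \<le> ext \<mu> x"
      using F G pos[of x] by (auto simp: ext_def intro: less_imp_le)
  next
    fix x y
    show "ext (\<lambda>x. F x * \<mu> x) x * ext (\<lambda>x. G x * \<mu> x) y \<le> ext (\<lambda>x. F x * G x * \<mu> x) (x \<union> y) * ext \<mu> (x \<inter> y)"
    proof (cases "x \<in> \<X> \<and> y \<in> \<X>")
      case True
      then have xy: "x \<in> \<X>" "y \<in> \<X>" "x \<union> y \<in> \<X>" "x \<inter> y \<in> \<X>"
        using Un_closed Int_closed by auto
      have "F x * G y \<le> F (x \<union> y) * G (x \<union> y)"
        using xy F G F_mono[of x "x \<union> y"] G_mono[of y "x \<union> y"] by (intro mult_mono) auto
      then have "(F x * G y) * (\<mu> x * \<mu> y) \<le> (F (x \<union> y) * G (x \<union> y)) * (\<mu> (x \<union> y) * \<mu> (x \<inter> y))"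
        using xy F G pos[of x] pos[of y] supermodular[of x y]
        by (intro mult_mono[of "F x * G y" _ "\<mu> x * \<mu> y"]) auto
      then show ?thesis
        using xy by (simp add: ext_def mult_ac)
    next
      case False
      then show ?thesis
        using F G pos[of "x \<union> y"] pos[of "x \<inter> y"] by (auto simp: ext_def)
    qed
  qed
  then have "cov \<X> \<mu> F G \<ge> 0"
    by (simp add: sum_ext cov_def)
  then show ?thesis
    by (simp add: F_def G_def cov_add_const)
qed

lemma fkg_subfamily:
  assumes "\<Y> \<subseteq> \<X>"
    and "\<And>x y. x \<in> \<Y> \<Longrightarrow> y \<in> \<Y> \<Longrightarrow> x \<union> y \<in> \<Y> \<and> x \<inter> y \<in> \<Y>"
  shows "fkg_family \<Y> \<mu>"
proof
  show "finite \<Y>" using finite_family assms(1) by (rule finite_subset[rotated])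
qed (use assms finite_member pos in \<open>auto intro: supermodular\<close>)

lemma fkg_slice: "fkg_family (slice \<X> p b) \<mu>"
  by (rule fkg_subfamily) (use Un_closed Int_closed in \<open>auto simp: slice_def\<close>)

end

section \<open>Conditioning on a point\<close>

abbreviation pt :: "'p \<Rightarrow> 'p set \<Rightarrow> real" where "pt p x \<equiv> of_bool (p \<in> x)"

lemma monotone_pt: "monotone_on \<X> (\<subseteq>) (\<le>) (pt p)"
  by (auto intro!: monotone_onI)

lemma sum_slices:
  fixes h :: "'p set \<Rightarrow> real"
  assumes "finite \<X>"
  shows "sum h \<X> = sum h (slice \<X> p True) + sum h (slice \<X> p False)"
proof -
  have "\<X> = slice \<X> p True \<union> slice \<X> p False"
    by (auto simp: slice_def)
  moreover have "sum h (slice \<X> p True \<union> slice \<X> p False) = sum h (slice \<X> p True) + sum h (slice \<X> p False)"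
    using assms by (intro sum.union_disjoint) (auto simp: slice_def)
  ultimately show ?thesis by simp
qed

lemma sum_pt:
  fixes h :: "'p set \<Rightarrow> real"
  assumes "finite \<X>"
  shows "(\<Sum>x\<in>\<X>. pt p x * h x) = sum h (slice \<X> p True)"
  using assms by (auto simp: slice_def intro!: sum.mono_neutral_cong_right)

lemma cov_pt:
  assumes "finite \<X>"
  shows "cov \<X> \<mu> f (pt p) =
      (\<Sum>x\<in>slice \<X> p True. f x * \<mu> x) * sum \<mu> (slice \<X> p False)
    - (\<Sum>x\<in>slice \<X> p False. f x * \<mu> x) * sum \<mu> (slice \<X> p True)"
proof -
  have "(\<Sum>x\<in>\<X>. f x * pt p x * \<mu> x) = (\<Sum>x\<in>slice \<X> p True. f x * \<mu> x)"
    unfolding sum_pt[OF assms, symmetric] by (intro sum.cong) (simp_all add: mult_ac)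
  then have "cov \<X> \<mu> f (pt p) = (\<Sum>x\<in>slice \<X> p True. f x * \<mu> x) * sum \<mu> \<X>
      - (\<Sum>x\<in>\<X>. f x * \<mu> x) * sum \<mu> (slice \<X> p True)"
    by (simp only: cov_def sum_pt[OF assms])
  also have "\<dots> = (\<Sum>x\<in>slice \<X> p True. f x * \<mu> x) * sum \<mu> (slice \<X> p False)
    - (\<Sum>x\<in>slice \<X> p False. f x * \<mu> x) * sum \<mu> (slice \<X> p True)"
    unfolding sum_slices[OF assms, of _ p] by (simp only: algebra_simps)
  finally show ?thesis .
qed

text \<open>
  The law of total covariance for the partition into the sets containing \<open>p\<close> and those avoiding it,
  cleared of denominators.
\<close>

lemma cov_slices:
  assumes "finite \<X>"
  shows "sum \<mu> (slice \<X> p True) * sum \<mu> (slice \<X> p False) * cov \<X> \<mu> f g =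
      sum \<mu> \<X> * sum \<mu> (slice \<X> p False) * cov (slice \<X> p True) \<mu> f g
    + sum \<mu> \<X> * sum \<mu> (slice \<X> p True) * cov (slice \<X> p False) \<mu> f g
    + cov \<X> \<mu> f (pt p) * cov \<X> \<mu> g (pt p)"
  unfolding cov_pt[OF assms] unfolding cov_def[of _ _ f g] sum_slices[OF assms, of _ p]
  by (simp only: algebra_simps)

context fkg_family begin

text \<open>
  All three terms on the right-hand side of \<open>cov_slices\<close> are non-negative by FKG, so they vanish
  together with the covariance.
\<close>

lemma cov_slices_eq_0:
  assumes f: "monotone_on \<X> (\<subseteq>) (\<le>) f" and g: "monotone_on \<X> (\<subseteq>) (\<le>) g"
    and zero: "cov \<X> \<mu> f g = 0"
  shows "cov (slice \<X> p b) \<mu> f g = 0"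
    and "cov \<X> \<mu> f (pt p) = 0 \<or> cov \<X> \<mu> g (pt p) = 0"
proof -
  let ?S = "slice \<X> p"
  have "(\<forall>b. cov (?S b) \<mu> f g = 0) \<and> (cov \<X> \<mu> f (pt p) = 0 \<or> cov \<X> \<mu> g (pt p) = 0)"
  proof (cases "\<exists>b. ?S b = {}")
    case True
    then obtain b where b: "?S b = {}" by blast
    \<comment> \<open>If all sets or none contain \<open>p\<close>, then \<open>cov_slices\<close> reads \<open>0 = 0\<close>, but conditioning is trivial.\<close>
    have whole: "?S (\<not> b) = \<X>" using b by (cases b) (auto simp: slice_def)
    have "cov (?S b) \<mu> f g = 0" unfolding b cov_def by simp
    moreover have "cov (?S (\<not> b)) \<mu> f g = 0" unfolding whole by (rule zero)
    ultimately have "cov (?S b') \<mu> f g = 0" for b'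
      by (cases b; cases b') simp_all
    moreover have "cov \<X> \<mu> f (pt p) = 0"
      using b unfolding cov_pt[OF finite_family] by (cases b) simp_all
    ultimately show ?thesis by blast
  next
    case False
    have posS: "sum \<mu> (?S b) > 0" for b
      using False finite_family pos by (intro sum_pos finite_slice) (auto simp: slice_def)
    then have posX: "sum \<mu> \<X> > 0"
      unfolding sum_slices[OF finite_family, of \<mu> p] by (intro add_pos_pos)
    have nn: "cov (?S b) \<mu> f g \<ge> 0" for b
      by (rule fkg_family.fkg[OF fkg_slice monotone_on_subset[OF f slice_subset]
            monotone_on_subset[OF g slice_subset]])
    have nnf: "cov \<X> \<mu> f (pt p) \<ge> 0" and nng: "cov \<X> \<mu> g (pt p) \<ge> 0"
      by (rule fkg[OF f monotone_pt], rule fkg[OF g monotone_pt])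
    define u v w where "u = sum \<mu> \<X> * sum \<mu> (?S False) * cov (?S True) \<mu> f g"
      and "v = sum \<mu> \<X> * sum \<mu> (?S True) * cov (?S False) \<mu> f g"
      and "w = cov \<X> \<mu> f (pt p) * cov \<X> \<mu> g (pt p)"
    have "u + v + w = 0"
      using cov_slices[OF finite_family, of \<mu> p f g] zero by (simp add: u_def v_def w_def)
    moreover have "u \<ge> 0" "v \<ge> 0" "w \<ge> 0"
      unfolding u_def v_def w_def using posX posS nn nnf nng
      by (meson less_imp_le mult_nonneg_nonneg)+
    ultimately have "u = 0" "v = 0" "w = 0" by linarith+
    then have "cov (?S True) \<mu> f g = 0" "cov (?S False) \<mu> f g = 0"
      using posX posS[of True] posS[of False] by (simp_all add: u_def v_def)
    then have "cov (?S b) \<mu> f g = 0" for b by (cases b) simp_all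
    with \<open>w = 0\<close> show ?thesis by (simp add: w_def)
  qed
  then show "cov (?S b) \<mu> f g = 0" "cov \<X> \<mu> f (pt p) = 0 \<or> cov \<X> \<mu> g (pt p) = 0" by blast+
qed

end

section \<open>Conditioning on a set of points\<close>

text \<open>
  The outcome of conditioning on every point of \<open>D\<close>, present or absent as in \<open>a\<close>.
\<close>

definition agree :: "'p set set \<Rightarrow> 'p set \<Rightarrow> 'p set \<Rightarrow> 'p set set" where
  "agree \<X> D a = {x \<in> \<X>. x \<inter> D = a \<inter> D}"

lemma agree_empty [simp]: "agree \<X> {} a = \<X>"
  by (simp add: agree_def)

lemma agree_insert: "agree \<X> (insert p D) a = slice (agree \<X> D a) p (p \<in> a)"
  by (auto simp: agree_def slice_def)

lemma agree_commute: "agree (agree \<X> E b) D a = agree (agree \<X> D a) E b"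
  by (auto simp: agree_def)

lemma agree_subset: "agree \<X> D a \<subseteq> \<X>"
  by (auto simp: agree_def)

context fkg_family begin

lemma fkg_agree: "fkg_family (agree \<X> D a) \<mu>"
  by (rule fkg_subfamily) (auto simp: agree_def Un_closed Int_closed Int_Un_distrib2)

text \<open>
  An equality case of FKG passes to every family that arises by conditioning.
\<close>

lemma cov_agree_eq_0:
  assumes "finite D" "monotone_on \<X> (\<subseteq>) (\<le>) f" "monotone_on \<X> (\<subseteq>) (\<le>) g" "cov \<X> \<mu> f g = 0"
  shows "cov (agree \<X> D a) \<mu> f g = 0"
  using assms(1)
proof induction
  case empty
  then show ?case using assms(4) by simp
next
  case (insert p D)
  then show ?case
    unfolding agree_insert
    by (intro fkg_family.cov_slices_eq_0(1)[OF fkg_agree] monotone_on_subset[OF assms(2) agree_subset]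
        monotone_on_subset[OF assms(3) agree_subset])
qed

text \<open>
  For nested \<open>y \<subset> x\<close> with nothing of \<open>\<X>\<close> strictly between, conditioning on all points outside
  \<open>x - y\<close> leaves the family \<open>{x, y}\<close>. There \<open>f\<close> is uncorrelated with any point that tells \<open>x\<close>
  and \<open>y\<close> apart, since such a point lies outside of \<open>A\<close>; so \<open>f x = f y\<close>. Other pairs are joined through \<open>x \<inter> y\<close> by chains of such steps.
\<close>

lemma depends_on:
  assumes f: "monotone_on \<X> (\<subseteq>) (\<le>) f"
    and indep: "\<And>q. q \<notin> A \<Longrightarrow> cov \<X> \<mu> f (pt q) = 0"
    and x: "x \<in> \<X>" and y: "y \<in> \<X>" and eq: "x \<inter> A = y \<inter> A"
  shows "f x = f y"
proof -
  have nested: "f x = f y" if "x \<in> \<X>" "y \<in> \<X>" "y \<subseteq> x" "x \<inter> A = y \<inter> A" for x y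
    using that
  proof (induction "card (x - y)" arbitrary: x y rule: less_induct)
    case less
    show ?case
    proof (cases "\<exists>z\<in>\<X>. y \<subset> z \<and> z \<subset> x")
      case True
      then obtain z where z: "z \<in> \<X>" "y \<subset> z" "z \<subset> x" by blast
      have fin: "finite (x - y)" using less.prems finite_member by blast
      have "card (x - z) < card (x - y)" "card (z - y) < card (x - y)"
        using z fin by (auto intro!: psubset_card_mono)
      then have "f x = f z" "f z = f y"
        using z less.prems by (auto intro!: less.hyps)
      then show ?thesis by simp
    next
      case False
      show ?thesis
      proof (cases "x = y")
        case False
        then obtain q where q: "q \<in> x" "q \<notin> y" using less.prems by blast
        \<comment> \<open>Only finitely many points occur in \<open>\<X>\<close>, and these suffice for the conditioning.\<close>
        let ?I = "agree \<X> (\<Union>\<X> - (x - y)) x"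
        have I: "?I = {x, y}"
        proof
          show "?I \<subseteq> {x, y}"
          proof
            fix z assume "z \<in> ?I"
            then have "z \<in> \<X>" "y \<subseteq> z" "z \<subseteq> x"
              using less.prems by (auto simp: agree_def)
            then show "z \<in> {x, y}" using \<open>\<not> (\<exists>z\<in>\<X>. y \<subset> z \<and> z \<subset> x)\<close> by blast
          qed
        qed (use less.prems in \<open>auto simp: agree_def\<close>)
        have "finite (\<Union>\<X> - (x - y))"
          using finite_family finite_member by blast
        then have "cov ?I \<mu> f (pt q) = 0"
          using f q less.prems by (intro cov_agree_eq_0 monotone_pt indep) auto
        then have "cov {x, y} \<mu> f (pt q) = 0" by (simp add: I)
        then have "(f x - f y) * (\<mu> x * \<mu> y) = 0"
          using False q by (simp add: cov_def algebra_simps)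
        then show ?thesis using pos[of x] pos[of y] less.prems by simp
      qed simp
    qed
  qed
  have "f x = f (x \<inter> y)" "f y = f (x \<inter> y)"
    using x y eq Int_closed by (auto intro!: nested)
  then show ?thesis by simp
qed

section \<open>From uncorrelated points to a product\<close>

text \<open>
  For indicators, being uncorrelated is independence, and independence passes to complements.
\<close>

lemma pt_indep:
  assumes "cov \<X> \<mu> (pt p) (pt q) = 0"
  shows "sum \<mu> (slice (slice \<X> p b) q c) * sum \<mu> \<X> = sum \<mu> (slice \<X> p b) * sum \<mu> (slice \<X> q c)"
proof -
  define W where "W = (\<lambda>b c. sum \<mu> (slice (slice \<X> p b) q c))"
  have p: "sum \<mu> (slice \<X> p b) = W b True + W b False" for b
    unfolding W_def using finite_family by (intro sum_slices finite_slice)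
  have q: "sum \<mu> (slice \<X> q c) = W True c + W False c" for c
    unfolding W_def slice_commute[of _ p _ q] using finite_family by (intro sum_slices finite_slice)
  have all: "sum \<mu> \<X> = W True True + W True False + (W False True + W False False)"
    using sum_slices[OF finite_family, of \<mu> p] unfolding p .
  have pq: "(\<Sum>x\<in>slice \<X> q c. pt p x * \<mu> x) = W True c" for c
    unfolding W_def slice_commute[of _ p _ q] using finite_family by (intro sum_pt finite_slice)
  have "W True True * W False False = W True False * W False True"
    using assms unfolding cov_pt[OF finite_family] pq q by (simp add: algebra_simps)
  then have "W b c * sum \<mu> \<X> = (W b True + W b False) * (W True c + W False c)"
    unfolding all by (cases b; cases c) (simp_all add: algebra_simps)
  then show ?thesis by (simp add: p q W_def)
qed

text \<open>
  Points that are merely pairwise independent of \<open>q\<close> need not be jointly independent of it in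
  general. Here they are: after conditioning on \<open>D\<close>, the next point \<open>p\<close> is still uncorrelated with
  \<open>q\<close>, so revealing \<open>p\<close> does not change the conditional probability of \<open>q\<close>.
\<close>

lemma agree_slice_indep:
  assumes "finite D" "\<And>p. p \<in> D \<Longrightarrow> cov \<X> \<mu> (pt p) (pt q) = 0"
  shows "sum \<mu> (slice (agree \<X> D a) q c) * sum \<mu> \<X> = sum \<mu> (agree \<X> D a) * sum \<mu> (slice \<X> q c)"
  using assms
proof (induction D rule: finite_induct)
  case empty
  then show ?case by simp
next
  case (insert p D)
  let ?Y = "agree \<X> D a" and ?b = "p \<in> a"
  show ?case
  proof (cases "?Y = {}")
    case True
    then show ?thesis by (simp add: agree_insert slice_def)
  next
    case False
    have "cov ?Y \<mu> (pt p) (pt q) = 0"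
      using insert by (intro cov_agree_eq_0 monotone_pt) auto
    note step = fkg_family.pt_indep[OF fkg_agree this, of ?b c]
    have IH: "sum \<mu> (slice ?Y q c) * sum \<mu> \<X> = sum \<mu> ?Y * sum \<mu> (slice \<X> q c)"
      using insert by auto
    have "sum \<mu> ?Y * (sum \<mu> (slice (slice ?Y p ?b) q c) * sum \<mu> \<X>)
        = sum \<mu> (slice ?Y p ?b) * (sum \<mu> (slice ?Y q c) * sum \<mu> \<X>)"
      using step by (simp add: mult_ac)
    also have "\<dots> = sum \<mu> ?Y * (sum \<mu> (slice ?Y p ?b) * sum \<mu> (slice \<X> q c))"
      unfolding IH by (simp add: mult_ac)
    finally show ?thesis
      using False sum_eq_0_iff[OF agree_subset] by (simp add: agree_insert)
  qed
qed

text \<open>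
  The same induction on \<open>E\<close>, with \<open>agree_slice_indep\<close> applied inside the family already
  conditioned on \<open>E\<close>.
\<close>

lemma agree_indep:
  assumes "finite D" "finite E" "\<And>p q. p \<in> D \<Longrightarrow> q \<in> E \<Longrightarrow> cov \<X> \<mu> (pt p) (pt q) = 0"
  shows "sum \<mu> (agree (agree \<X> D a) E b) * sum \<mu> \<X> = sum \<mu> (agree \<X> D a) * sum \<mu> (agree \<X> E b)"
  using assms(2,3)
proof (induction E rule: finite_induct)
  case empty
  then show ?case by simp
next
  case (insert q E)
  let ?Y = "agree \<X> E b" and ?c = "q \<in> b"
  show ?case
  proof (cases "?Y = {}")
    case True
    then show ?thesis
      unfolding agree_commute[of _ _ _ _ b] agree_insert by (simp add: slice_def agree_def[of "{}"])
  next
    case False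
    have step: "sum \<mu> (slice (agree ?Y D a) q ?c) * sum \<mu> ?Y = sum \<mu> (agree ?Y D a) * sum \<mu> (slice ?Y q ?c)"
      using insert assms(1)
      by (intro fkg_family.agree_slice_indep[OF fkg_agree] cov_agree_eq_0 monotone_pt) auto
    have IH: "sum \<mu> (agree ?Y D a) * sum \<mu> \<X> = sum \<mu> (agree \<X> D a) * sum \<mu> ?Y"
      using insert agree_commute[of \<X>] by auto
    have "sum \<mu> ?Y * (sum \<mu> (slice (agree ?Y D a) q ?c) * sum \<mu> \<X>)
      = (sum \<mu> (agree ?Y D a) * sum \<mu> \<X>) * sum \<mu> (slice ?Y q ?c)"
      using step by (simp add: mult_ac)
    also have "\<dots> = sum \<mu> ?Y * (sum \<mu> (agree \<X> D a) * sum \<mu> (slice ?Y q ?c))"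
      unfolding IH by (simp add: mult_ac)
    finally have "sum \<mu> (slice (agree ?Y D a) q ?c) * sum \<mu> \<X> = sum \<mu> (agree \<X> D a) * sum \<mu> (slice ?Y q ?c)"
      using False sum_eq_0_iff[OF agree_subset] by simp
    then show ?thesis
      by (simp only: agree_insert agree_commute[of \<X> E b D a])
  qed
qed

text \<open>
  The traces of the random set on \<open>A\<close> and on the complement are independent, and a set is determined
  by its two traces. So the weight of the set with the trace of \<open>x\<close> on \<open>A\<close> and that of \<open>y\<close> outside
  is a product \<open>\<alpha> x * \<beta> y\<close>, up to the total mass. A positive product forces this set into \<open>\<X>\<close>.
\<close>

lemma exchange:
  assumes indep: "\<And>p q. p \<in> A \<Longrightarrow> q \<notin> A \<Longrightarrow> cov \<X> \<mu> (pt p) (pt q) = 0"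
    and x: "x \<in> \<X>" and y: "y \<in> \<X>"
  shows "(x \<inter> A) \<union> (y - A) \<in> \<X>"
    and "\<mu> x * \<mu> y = \<mu> ((x \<inter> A) \<union> (y - A)) * \<mu> ((y \<inter> A) \<union> (x - A))"
proof -
  define \<alpha> \<beta> where "\<alpha> = (\<lambda>x. sum \<mu> (agree \<X> (\<Union>\<X> \<inter> A) x))" and "\<beta> = (\<lambda>x. sum \<mu> (agree \<X> (\<Union>\<X> - A) x))"
  let ?s = "\<lambda>x y. (x \<inter> A) \<union> (y - A)"
  have fin: "finite (\<Union>\<X> \<inter> A)" "finite (\<Union>\<X> - A)"
    using finite_family finite_member by blast+
  have cell: "agree (agree \<X> (\<Union>\<X> \<inter> A) x) (\<Union>\<X> - A) y = {z \<in> \<X>. z = ?s x y}"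
    if "x \<in> \<X>" "y \<in> \<X>" for x y
    using that unfolding agree_def by blast
  have indep': "sum \<mu> {z \<in> \<X>. z = ?s x y} * sum \<mu> \<X> = \<alpha> x * \<beta> y" if "x \<in> \<X>" "y \<in> \<X>" for x y
    using agree_indep[OF fin, of x y] indep unfolding cell[OF that] \<alpha>_def \<beta>_def by auto
  have "agree \<X> D x \<noteq> {}" if "x \<in> \<X>" for D x using that by (auto simp: agree_def)
  then have nz: "\<alpha> x \<noteq> 0" "\<beta> x \<noteq> 0" if "x \<in> \<X>" for x
    using that sum_eq_0_iff[OF agree_subset] by (simp_all add: \<alpha>_def \<beta>_def)
  have mem: "?s x y \<in> \<X>" if "x \<in> \<X>" "y \<in> \<X>" for x y
  proof (rule ccontr)
    assume "?s x y \<notin> \<X>"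
    then have "sum \<mu> {z \<in> \<X>. z = ?s x y} = 0" by (intro sum.neutral) blast
    then show False using indep'[OF that] nz[OF that(1)] nz[OF that(2)] by simp
  qed
  have prod: "\<mu> (?s x y) * sum \<mu> \<X> = \<alpha> x * \<beta> y" if "x \<in> \<X>" "y \<in> \<X>" for x y
  proof -
    have "{z \<in> \<X>. z = ?s x y} = {?s x y}" using mem[OF that] by blast
    then show ?thesis using indep'[OF that] by simp
  qed
  \<comment> \<open>The weights of \<open>x\<close> and \<open>y\<close> are products too, as \<open>x\<close> is the exchange of \<open>x\<close> with itself.\<close>
  have id: "?s x x = x" for x by blast
  have "(\<mu> x * sum \<mu> \<X>) * (\<mu> y * sum \<mu> \<X>) = (\<mu> (?s x y) * sum \<mu> \<X>) * (\<mu> (?s y x) * sum \<mu> \<X>)"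
    using prod[OF x x] prod[OF y y] prod[OF x y] prod[OF y x] unfolding id by (simp add: mult_ac)
  moreover have "sum \<mu> \<X> \<noteq> 0" using x sum_eq_0_iff[of \<X>] by blast
  ultimately show "\<mu> x * \<mu> y = \<mu> (?s x y) * \<mu> (?s y x)" by simp
  show "?s x y \<in> \<X>" using mem x y by blast
qed

text \<open>
  The points of \<open>A\<close> are those correlated with \<open>f\<close>. A point correlated with neither function may go
  to either side; it goes to that of \<open>g\<close>.
\<close>

theorem fkg_equality_splits:
  assumes f: "monotone_on \<X> (\<subseteq>) (\<le>) f" and g: "monotone_on \<X> (\<subseteq>) (\<le>) g"
    and zero: "cov \<X> \<mu> f g = 0"
  obtains A where
    "\<And>x y. x \<in> \<X> \<Longrightarrow> y \<in> \<X> \<Longrightarrow> (x \<inter> A) \<union> (y - A) \<in> \<X>"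
    "\<And>x y. x \<in> \<X> \<Longrightarrow> y \<in> \<X> \<Longrightarrow>
      \<mu> x * \<mu> y = \<mu> ((x \<inter> A) \<union> (y - A)) * \<mu> ((y \<inter> A) \<union> (x - A))"
    "\<And>x y. x \<in> \<X> \<Longrightarrow> y \<in> \<X> \<Longrightarrow> x \<inter> A = y \<inter> A \<Longrightarrow> f x = f y"
    "\<And>x y. x \<in> \<X> \<Longrightarrow> y \<in> \<X> \<Longrightarrow> x - A = y - A \<Longrightarrow> g x = g y"
proof
  define A where "A = {p. cov \<X> \<mu> f (pt p) \<noteq> 0}"
  have fA: "cov \<X> \<mu> f (pt q) = 0" if "q \<notin> A" for q using that by (simp add: A_def)
  \<comment> \<open>This is where the equality hypothesis enters: no point is correlated with both.\<close>
  have gA: "cov \<X> \<mu> g (pt p) = 0" if "p \<notin> - A" for p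
    using cov_slices_eq_0(2)[OF f g zero, of p] that by (simp add: A_def)
  have indep: "cov \<X> \<mu> (pt p) (pt q) = 0" if "p \<in> A" "q \<notin> A" for p q
    using cov_slices_eq_0(2)[OF f monotone_pt fA[OF that(2)], of p] that(1)
    by (simp add: A_def cov_commute)
  fix x y assume xy: "x \<in> \<X>" "y \<in> \<X>"
  show "(x \<inter> A) \<union> (y - A) \<in> \<X>"
    "\<mu> x * \<mu> y = \<mu> ((x \<inter> A) \<union> (y - A)) * \<mu> ((y \<inter> A) \<union> (x - A))"
    using exchange[OF indep xy] by blast+
  show "x \<inter> A = y \<inter> A \<Longrightarrow> f x = f y"
    using depends_on[OF f fA xy] by blast
  show "x - A = y - A \<Longrightarrow> g x = g y"
    using depends_on[of g "- A", OF g gA xy] by (simp add: Diff_eq)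
qed

end

section \<open>Sublattices\<close>

context lattice begin

lemma sublattice_bounds:
  assumes S: "S \<subseteq> carrier L" and x: "x \<in> S" and y: "y \<in> S"
    and cl: "x \<squnion> y \<in> S" "x \<sqinter> y \<in> S"
  shows "least (L\<lparr>carrier := S\<rparr>) (x \<squnion> y) (Upper (L\<lparr>carrier := S\<rparr>) {x, y})"
    and "greatest (L\<lparr>carrier := S\<rparr>) (x \<sqinter> y) (Lower (L\<lparr>carrier := S\<rparr>) {x, y})"
proof -
  have C: "u \<in> carrier L" if "u \<in> S" for u using S that by blast
  note bounds = join_left[OF C C, OF x y] join_right[OF C C, OF x y]
    meet_left[OF C C, OF x y] meet_right[OF C C, OF x y]
  show "least (L\<lparr>carrier := S\<rparr>) (x \<squnion> y) (Upper (L\<lparr>carrier := S\<rparr>) {x, y})"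
    using x y cl bounds by (auto simp: least_def Upper_def intro!: join_le C)
  show "greatest (L\<lparr>carrier := S\<rparr>) (x \<sqinter> y) (Lower (L\<lparr>carrier := S\<rparr>) {x, y})"
    using x y cl bounds by (auto simp: greatest_def Lower_def intro!: meet_le C)
qed

lemma sublattice:
  assumes S: "S \<subseteq> carrier L"
    and cl: "\<forall>x\<in>S. \<forall>y\<in>S. x \<squnion> y \<in> S \<and> x \<sqinter> y \<in> S"
  defines "M \<equiv> L\<lparr>carrier := S\<rparr>"
  shows "lattice M"
    and "\<And>x y. x \<in> S \<Longrightarrow> y \<in> S \<Longrightarrow> x \<squnion>\<^bsub>M\<^esub> y = x \<squnion> y"
    and "\<And>x y. x \<in> S \<Longrightarrow> y \<in> S \<Longrightarrow> x \<sqinter>\<^bsub>M\<^esub> y = x \<sqinter> y"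
proof -
  interpret M: partial_order M
    using S by unfold_locales
      (auto simp: M_def eq_is_equal subset_iff intro: le_antisym le_trans)
  have bounds: "least M (x \<squnion> y) (Upper M {x, y})" "greatest M (x \<sqinter> y) (Lower M {x, y})"
    if "x \<in> S" "y \<in> S" for x y
    using sublattice_bounds[OF S that] cl that by (simp_all add: M_def)
  show "lattice M"
  proof
    fix x y assume "x \<in> carrier M" "y \<in> carrier M"
    then have "x \<in> S" "y \<in> S" by (simp_all add: M_def)
    then show "\<exists>s. least M s (Upper M {x, y})" "\<exists>s. greatest M s (Lower M {x, y})"
      using bounds by blast+
  qed
  then interpret M: lattice M .
  fix x y assume xy: "x \<in> S" "y \<in> S"
  show "x \<squnion>\<^bsub>M\<^esub> y = x \<squnion> y"
    unfolding join_def[of M] sup_def using bounds(1)[OF xy] by (blast intro: M.least_unique someI2)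
  show "x \<sqinter>\<^bsub>M\<^esub> y = x \<sqinter> y"
    unfolding meet_def[of M] inf_def using bounds(2)[OF xy] by (blast intro: M.greatest_unique someI2)
qed

end

context distributive_lattice begin

lemma distributive_sublattice:
  assumes S: "S \<subseteq> carrier L"
    and cl: "\<forall>x\<in>S. \<forall>y\<in>S. x \<squnion> y \<in> S \<and> x \<sqinter> y \<in> S"
  shows "distributive_lattice (L\<lparr>carrier := S\<rparr>)"
proof -
  interpret M: lattice "L\<lparr>carrier := S\<rparr>"
    using assms by (rule sublattice(1))
  show ?thesis
    by unfold_locales
      (use S cl in \<open>auto simp: sublattice(2,3)[OF S cl] subset_iff intro!: meet_join_distrib\<close>)
qed

section \<open>Representation by sets of join-prime elements\<close>

text \<open>
  The first condition says that \<open>p\<close> is not the bottom element, whose set of primes is then empty.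
\<close>

definition join_primes :: "'a set" where
  "join_primes = {p \<in> carrier L. (\<exists>y\<in>carrier L. \<not> p \<sqsubseteq> y) \<and>
     (\<forall>a\<in>carrier L. \<forall>b\<in>carrier L. p \<sqsubseteq> a \<squnion> b \<longrightarrow> p \<sqsubseteq> a \<or> p \<sqsubseteq> b)}"

definition primes_below :: "'a \<Rightarrow> 'a set" where
  "primes_below x = {p \<in> join_primes. p \<sqsubseteq> x}"

lemma primes_below_mono:
  assumes "x \<in> carrier L" "y \<in> carrier L" "x \<sqsubseteq> y"
  shows "primes_below x \<subseteq> primes_below y"
  using assms le_trans[of _ x y] by (auto simp: primes_below_def join_primes_def)

lemma primes_below_join:
  assumes "x \<in> carrier L" "y \<in> carrier L"
  shows "primes_below (x \<squnion> y) = primes_below x \<union> primes_below y"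
proof
  show "primes_below (x \<squnion> y) \<subseteq> primes_below x \<union> primes_below y"
    using assms by (auto simp: primes_below_def join_primes_def)
  show "primes_below x \<union> primes_below y \<subseteq> primes_below (x \<squnion> y)"
    using assms by (intro Un_least primes_below_mono join_left join_right join_closed)
qed

lemma primes_below_meet:
  assumes "x \<in> carrier L" "y \<in> carrier L"
  shows "primes_below (x \<sqinter> y) = primes_below x \<inter> primes_below y"
proof
  show "primes_below (x \<sqinter> y) \<subseteq> primes_below x \<inter> primes_below y"
    using assms by (intro Int_greatest primes_below_mono meet_left meet_right meet_closed)
  show "primes_below x \<inter> primes_below y \<subseteq> primes_below (x \<sqinter> y)"
    using assms by (auto simp: primes_below_def join_primes_def intro!: meet_le)
qed

text \<open>
  If \<open>x \<sqsubseteq> y\<close> fails, a minimal \<open>p\<close> among the elements below \<open>x\<close> but not below \<open>y\<close> separates them.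
  By distributivity it is join-prime: if \<open>p \<sqsubseteq> a \<squnion> b\<close> with \<open>p\<close> below neither, then \<open>p \<sqinter> a\<close> and
  \<open>p \<sqinter> b\<close> are strictly below \<open>p\<close>, hence below \<open>y\<close>, and so is their join \<open>p\<close>.
\<close>

lemma primes_below_subset_iff:
  assumes fin: "finite (carrier L)" and x: "x \<in> carrier L" and y: "y \<in> carrier L"
  shows "primes_below x \<subseteq> primes_below y \<longleftrightarrow> x \<sqsubseteq> y"
proof
  assume "x \<sqsubseteq> y"
  then show "primes_below x \<subseteq> primes_below y" by (rule primes_below_mono[OF x y])
next
  assume sub: "primes_below x \<subseteq> primes_below y"
  show "x \<sqsubseteq> y"
  proof (rule ccontr)
    assume nle: "\<not> x \<sqsubseteq> y"
    define B where "B = {z \<in> carrier L. z \<sqsubseteq> x \<and> \<not> z \<sqsubseteq> y}"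
    \<comment> \<open>Minimality is measured by the number of elements below.\<close>
    define down where "down = (\<lambda>z. {w \<in> carrier L. w \<sqsubseteq> z})"
    have "x \<in> B" using x nle by (simp add: B_def)
    then obtain p where p: "p \<in> B" and min: "\<And>z. z \<in> B \<Longrightarrow> card (down p) \<le> card (down z)"
      using arg_min_nat_lemma[of "\<lambda>z. z \<in> B" x "\<lambda>z. card (down z)"] by blast
    have pC: "p \<in> carrier L" "p \<sqsubseteq> x" "\<not> p \<sqsubseteq> y" using p by (auto simp: B_def)
    have strict: "z \<sqsubseteq> y \<or> z = p" if z: "z \<in> carrier L" "z \<sqsubseteq> p" for z
    proof (rule ccontr)
      assume neg: "\<not> (z \<sqsubseteq> y \<or> z = p)"
      then have "z \<in> B" using z pC x le_trans[of z p x] by (auto simp: B_def)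
      moreover have "\<not> p \<sqsubseteq> z" using neg z pC le_antisym[of z p] by blast
      then have "down z \<subset> down p"
        using z pC le_trans[of _ z p] unfolding down_def by auto
      then have "card (down z) < card (down p)"
        using fin by (intro psubset_card_mono) (auto simp: down_def)
      ultimately show False using min by fastforce
    qed
    have "p \<sqsubseteq> a \<or> p \<sqsubseteq> b" if ab: "a \<in> carrier L" "b \<in> carrier L" "p \<sqsubseteq> a \<squnion> b" for a b
    proof (rule ccontr)
      assume neg: "\<not> (p \<sqsubseteq> a \<or> p \<sqsubseteq> b)"
      have "p \<sqinter> a \<noteq> p" "p \<sqinter> b \<noteq> p"
        using neg ab pC le_iff_join[of p a] le_iff_join[of p b] by auto
      then have "p \<sqinter> a \<sqsubseteq> y" "p \<sqinter> b \<sqsubseteq> y"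
        using strict[of "p \<sqinter> a"] strict[of "p \<sqinter> b"] ab pC meet_left[of p a] meet_left[of p b] by auto
      then have "(p \<sqinter> a) \<squnion> (p \<sqinter> b) \<sqsubseteq> y"
        using ab pC y by (intro join_le) auto
      moreover have "p = (p \<sqinter> a) \<squnion> (p \<sqinter> b)"
        using ab pC le_iff_join[of p "a \<squnion> b"] meet_join_distrib[of p a b] by simp
      ultimately show False using pC by simp
    qed
    then have "p \<in> join_primes" using pC y by (auto simp: join_primes_def)
    then have "p \<in> primes_below x" "p \<notin> primes_below y" using pC by (auto simp: primes_below_def)
    then show False using sub by blast
  qed
qed

lemma inj_on_primes_below:
  assumes "finite (carrier L)"
  shows "inj_on primes_below (carrier L)"
proof (rule inj_onI)
  fix x y assume xy: "x \<in> carrier L" "y \<in> carrier L" and eq: "primes_below x = primes_below y"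
  show "x = y"
    using primes_below_subset_iff[OF assms xy] primes_below_subset_iff[OF assms xy(2,1)] eq xy
    by (intro le_antisym) auto
qed

lemma ex_primes_below_empty:
  assumes fin: "finite (carrier L)" and ne: "carrier L \<noteq> {}"
  shows "\<exists>z\<in>carrier L. primes_below z = {}"
proof -
  obtain z where z: "z \<in> carrier L"
    and min: "\<And>x. x \<in> carrier L \<Longrightarrow> primes_below x \<subseteq> primes_below z \<Longrightarrow> primes_below x = primes_below z"
    using finite_has_minimal[of "primes_below ` carrier L"] fin ne by auto
  have "z \<sqsubseteq> x" if "x \<in> carrier L" for x
    using min[of "z \<sqinter> x"] z that primes_below_meet[of z x] primes_below_subset_iff[OF fin, of z x]
    by auto
  then have "primes_below z = {}" using z le_trans[of _ z] by (auto simp: primes_below_def join_primes_def)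
  then show ?thesis using z by blast
qed

end

lemma fkg_family_of_lattice:
  fixes L :: "'a gorder"
  assumes dl: "distributive_lattice L" and fin: "finite (carrier L)"
    and pos: "\<And>x. x \<in> carrier L \<Longrightarrow> \<mu> x > 0" and sm: "log_supermodular L \<mu>"
  defines "B \<equiv> distributive_lattice.primes_below L"
  shows "fkg_family (B ` carrier L) (\<mu> \<circ> inv_into (carrier L) B)"
proof -
  interpret distributive_lattice L by (rule dl)
  have inv: "inv_into (carrier L) B (B x) = x" if "x \<in> carrier L" for x
    using inv_into_f_f[OF inj_on_primes_below[OF fin] that] by (simp add: B_def)
  have join: "B x \<union> B y = B (x \<squnion>\<^bsub>L\<^esub> y)" and meet: "B x \<inter> B y = B (x \<sqinter>\<^bsub>L\<^esub> y)"
    if "x \<in> carrier L" "y \<in> carrier L" for x y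
    using primes_below_join[OF that] primes_below_meet[OF that] by (simp_all add: B_def)
  have "finite (B x)" for x
    using fin by (rule finite_subset[rotated]) (auto simp: B_def primes_below_def join_primes_def)
  then show ?thesis
    using fin pos sm by unfold_locales (auto simp: inv join meet log_supermodular_def)
qed

section \<open>The equality case\<close>

text \<open>
  Let \<open>A\<close> be the set of join-primes found by \<open>fkg_equality_splits\<close>. The factors are the elements
  all of whose primes lie in \<open>A\<close>, respectively outside of \<open>A\<close>, and the isomorphism takes joins.
  The exchange property for an element and the bottom provides the two components of the element;
  for a pair of components it gives the factorisation of \<open>\<mu>\<close>, normalised at the bottom.
\<close>

lemma splits_if_cov_eq_0:
  fixes L :: "'a gorder" and \<mu> f g :: "'a \<Rightarrow> real"
  assumes dl: "distributive_lattice L" and fin: "finite (carrier L)"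
    and pos: "\<And>x. x \<in> carrier L \<Longrightarrow> \<mu> x > 0" and sm: "log_supermodular L \<mu>"
    and f: "monotone_on (carrier L) (\<sqsubseteq>\<^bsub>L\<^esub>) (\<le>) f"
    and g: "monotone_on (carrier L) (\<sqsubseteq>\<^bsub>L\<^esub>) (\<le>) g"
    and zero: "cov (carrier L) \<mu> f g = 0"
  shows "\<exists>(L1 :: 'a gorder) (L2 :: 'a gorder). splits_as_product L \<mu> f g L1 L2"
proof (cases "carrier L = {}")
  case True
  \<comment> \<open>The empty lattice has no bottom element, but it is its own square.\<close>
  have lat: "lattice L" using dl by (rule distributive_lattice.axioms)
  have "lattice_isomorphism (direct_product L L) L fst"
    using lat lattice_direct_product[OF lat lat] True
    by (simp add: lattice_isomorphism_def join_pres_def meet_pres_def direct_product_def bij_betw_def)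
  then have "splits_as_product L \<mu> f g L L"
    unfolding splits_as_product_def using dl True by blast
  then show ?thesis by blast
next
  case False
  interpret distributive_lattice L by (rule dl)
  let ?C = "carrier L"
  define B where "B = primes_below"
  define r where "r = inv_into ?C B"
  have inj: "inj_on B ?C" unfolding B_def using fin by (rule inj_on_primes_below)
  have inv [simp]: "r (B x) = x" if "x \<in> ?C" for x
    using inv_into_f_f[OF inj that] by (simp add: r_def)
  have eqI: "x = y" if "B x = B y" "x \<in> ?C" "y \<in> ?C" for x y
    using inj_onD[OF inj that] .
  have B_join: "B (x \<squnion>\<^bsub>L\<^esub> y) = B x \<union> B y" and B_meet: "B (x \<sqinter>\<^bsub>L\<^esub> y) = B x \<inter> B y"
    if "x \<in> ?C" "y \<in> ?C" for x y
    using that by (simp_all add: B_def primes_below_join primes_below_meet)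
  obtain bot where bot: "bot \<in> ?C" "B bot = {}"
    using ex_primes_below_empty[OF fin False] by (auto simp: B_def)

  interpret X: fkg_family "B ` ?C" "\<mu> \<circ> r"
    unfolding B_def r_def using dl fin pos sm by (rule fkg_family_of_lattice)
  have mono: "monotone_on (B ` ?C) (\<subseteq>) (\<le>) (h \<circ> r)"
    if "monotone_on ?C (\<sqsubseteq>\<^bsub>L\<^esub>) (\<le>) h" for h :: "'a \<Rightarrow> real"
    using that primes_below_subset_iff[OF fin] by (auto simp: monotone_on_def B_def[symmetric])
  have "cov (B ` ?C) (\<mu> \<circ> r) (f \<circ> r) (g \<circ> r) = cov ?C \<mu> f g"
    using inj by (simp add: cov_def sum.reindex)
  then have "cov (B ` ?C) (\<mu> \<circ> r) (f \<circ> r) (g \<circ> r) = 0" using zero by simp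
  from X.fkg_equality_splits[OF mono[OF f] mono[OF g] this]
  obtain A where A: "\<And>X Y. X \<in> B ` ?C \<Longrightarrow> Y \<in> B ` ?C \<Longrightarrow> (X \<inter> A) \<union> (Y - A) \<in> B ` ?C"
    "\<And>X Y. X \<in> B ` ?C \<Longrightarrow> Y \<in> B ` ?C \<Longrightarrow>
      (\<mu> \<circ> r) X * (\<mu> \<circ> r) Y = (\<mu> \<circ> r) ((X \<inter> A) \<union> (Y - A)) * (\<mu> \<circ> r) ((Y \<inter> A) \<union> (X - A))"
    "\<And>X Y. X \<in> B ` ?C \<Longrightarrow> Y \<in> B ` ?C \<Longrightarrow> X \<inter> A = Y \<inter> A \<Longrightarrow> (f \<circ> r) X = (f \<circ> r) Y"
    "\<And>X Y. X \<in> B ` ?C \<Longrightarrow> Y \<in> B ` ?C \<Longrightarrow> X - A = Y - A \<Longrightarrow> (g \<circ> r) X = (g \<circ> r) Y"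
    by blast
  have f_dep: "f x = f y" if "x \<in> ?C" "y \<in> ?C" "B x \<inter> A = B y \<inter> A" for x y
    using A(3)[of "B x" "B y"] that by simp
  have g_dep: "g x = g y" if "x \<in> ?C" "y \<in> ?C" "B x - A = B y - A" for x y
    using A(4)[of "B x" "B y"] that by simp

  define C1 C2 where "C1 = {x \<in> ?C. B x \<subseteq> A}" and "C2 = {x \<in> ?C. B x \<inter> A = {}}"
  define L1 L2 where "L1 = L\<lparr>carrier := C1\<rparr>" and "L2 = L\<lparr>carrier := C2\<rparr>"
  have C1: "C1 \<subseteq> ?C" "\<forall>x\<in>C1. \<forall>y\<in>C1. x \<squnion>\<^bsub>L\<^esub> y \<in> C1 \<and> x \<sqinter>\<^bsub>L\<^esub> y \<in> C1"
    by (auto simp: C1_def B_join B_meet)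
  have C2: "C2 \<subseteq> ?C" "\<forall>x\<in>C2. \<forall>y\<in>C2. x \<squnion>\<^bsub>L\<^esub> y \<in> C2 \<and> x \<sqinter>\<^bsub>L\<^esub> y \<in> C2"
    by (auto simp: C2_def B_join B_meet)
  note sub1 = sublattice[OF C1, folded L1_def] and sub2 = sublattice[OF C2, folded L2_def]
  have carr [simp]: "carrier L1 = C1" "carrier L2 = C2" by (simp_all add: L1_def L2_def)
  define \<phi> where "\<phi> = (\<lambda>(x1, x2). x1 \<squnion>\<^bsub>L\<^esub> x2)"
  have \<phi>: "\<phi> (x1, x2) \<in> ?C" "B (\<phi> (x1, x2)) = B x1 \<union> B x2"
    "B (\<phi> (x1, x2)) \<inter> A = B x1" "B (\<phi> (x1, x2)) - A = B x2"
    "x1 \<in> ?C" "x2 \<in> ?C" "B x1 \<subseteq> A" "B x2 \<inter> A = {}"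
    if "x1 \<in> C1" "x2 \<in> C2" for x1 x2
    using that by (auto simp: \<phi>_def C1_def C2_def B_join)
  have carrP: "carrier (direct_product L1 L2) = C1 \<times> C2"
    by (simp add: direct_product_def)
  note latP = lattice_direct_product[OF sub1(1) sub2(1)]

  have "bij_betw \<phi> (C1 \<times> C2) ?C"
  proof (rule bij_betw_imageI)
    show "inj_on \<phi> (C1 \<times> C2)"
    proof (rule inj_onI, clarify)
      fix x1 x2 y1 y2
      assume xy: "x1 \<in> C1" "x2 \<in> C2" "y1 \<in> C1" "y2 \<in> C2" and "\<phi> (x1, x2) = \<phi> (y1, y2)"
      then have "B x1 = B y1" "B x2 = B y2"
        using \<phi>(3,4)[of x1 x2] \<phi>(3,4)[of y1 y2] by simp_all
      then show "x1 = y1 \<and> x2 = y2" using eqI xy by (auto simp: C1_def C2_def)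
    qed
    have "x \<in> \<phi> ` (C1 \<times> C2)" if x: "x \<in> ?C" for x
    proof -
      obtain x1 x2 where x12: "x1 \<in> ?C" "B x1 = B x \<inter> A" "x2 \<in> ?C" "B x2 = B x - A"
        using A(1)[OF imageI[OF x] imageI[OF bot(1)]] A(1)[OF imageI[OF bot(1)] imageI[OF x]]
        unfolding bot(2) by (auto elim!: imageE)
      then have m: "x1 \<in> C1" "x2 \<in> C2" by (auto simp: C1_def C2_def)
      then have "\<phi> (x1, x2) = x" using x12 x \<phi>[OF m] by (intro eqI) auto
      then show ?thesis using m by force
    qed
    then show "\<phi> ` (C1 \<times> C2) = ?C" using \<phi>(1) by auto
  qed
  moreover have "join_pres (direct_product L1 L2) L \<phi>"
    unfolding join_pres_def carrP
  proof (intro conjI latP lattice_axioms ballI)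
    fix P Q assume "P \<in> C1 \<times> C2" "Q \<in> C1 \<times> C2"
    then obtain x1 x2 y1 y2 where PQ: "P = (x1, x2)" "Q = (y1, y2)"
      and xy: "x1 \<in> C1" "x2 \<in> C2" "y1 \<in> C1" "y2 \<in> C2" by auto
    note cl = C1(2)[rule_format, OF xy(1,3)] C2(2)[rule_format, OF xy(2,4)]
    have "\<phi> (x1 \<squnion>\<^bsub>L\<^esub> y1, x2 \<squnion>\<^bsub>L\<^esub> y2) = \<phi> (x1, x2) \<squnion>\<^bsub>L\<^esub> \<phi> (y1, y2)"
      using cl \<phi>[OF xy(1,2)] \<phi>[OF xy(3,4)]
      by (intro eqI) (auto simp: \<phi>(1,2) B_join)
    then show "\<phi> (P \<squnion>\<^bsub>direct_product L1 L2\<^esub> Q) = \<phi> P \<squnion>\<^bsub>L\<^esub> \<phi> Q"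
      using xy by (simp add: PQ join_direct_product[OF sub1(1) sub2(1)] sub1(2) sub2(2))
  qed
  moreover have "meet_pres (direct_product L1 L2) L \<phi>"
    unfolding meet_pres_def carrP
  proof (intro conjI latP lattice_axioms ballI)
    fix P Q assume "P \<in> C1 \<times> C2" "Q \<in> C1 \<times> C2"
    then obtain x1 x2 y1 y2 where PQ: "P = (x1, x2)" "Q = (y1, y2)"
      and xy: "x1 \<in> C1" "x2 \<in> C2" "y1 \<in> C1" "y2 \<in> C2" by auto
    note cl = C1(2)[rule_format, OF xy(1,3)] C2(2)[rule_format, OF xy(2,4)]
    have "B (\<phi> (x1 \<sqinter>\<^bsub>L\<^esub> y1, x2 \<sqinter>\<^bsub>L\<^esub> y2)) = (B x1 \<inter> B y1) \<union> (B x2 \<inter> B y2)"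
      using cl \<phi>[OF xy(1,2)] \<phi>[OF xy(3,4)] by (simp add: \<phi>(2) B_meet)
    also have "\<dots> = (B x1 \<union> B x2) \<inter> (B y1 \<union> B y2)"
      using \<phi>(7,8)[OF xy(1,2)] \<phi>(7,8)[OF xy(3,4)] by blast
    also have "\<dots> = B (\<phi> (x1, x2) \<sqinter>\<^bsub>L\<^esub> \<phi> (y1, y2))"
      using \<phi>[OF xy(1,2)] \<phi>[OF xy(3,4)] by (simp add: B_meet)
    finally have "\<phi> (x1 \<sqinter>\<^bsub>L\<^esub> y1, x2 \<sqinter>\<^bsub>L\<^esub> y2) = \<phi> (x1, x2) \<sqinter>\<^bsub>L\<^esub> \<phi> (y1, y2)"
      using cl \<phi>(1)[OF xy(1,2)] \<phi>(1)[OF xy(3,4)] by (intro eqI) (auto simp: \<phi>(1))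
    then show "\<phi> (P \<sqinter>\<^bsub>direct_product L1 L2\<^esub> Q) = \<phi> P \<sqinter>\<^bsub>L\<^esub> \<phi> Q"
      using xy by (simp add: PQ meet_direct_product[OF sub1(1) sub2(1)] sub1(3) sub2(3))
  qed
  ultimately have iso: "lattice_isomorphism (direct_product L1 L2) L \<phi>"
    by (simp add: lattice_isomorphism_def carrP)

  have coordinates: "f (\<phi> (x1, x2)) = f x1" "g (\<phi> (x1, x2)) = g x2" "\<mu> (\<phi> (x1, x2)) = \<mu> x1 * (\<mu> x2 / \<mu> bot)"
    if "x1 \<in> C1" "x2 \<in> C2" for x1 x2
  proof -
    note p = \<phi>[OF that]
    show "f (\<phi> (x1, x2)) = f x1" "g (\<phi> (x1, x2)) = g x2"
      using p by (auto intro!: f_dep g_dep)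
    have swap: "(B x1 \<inter> A) \<union> (B x2 - A) = B (\<phi> (x1, x2))" "(B x2 \<inter> A) \<union> (B x1 - A) = B bot"
      using p bot by auto
    have "\<mu> x1 * \<mu> x2 = \<mu> (\<phi> (x1, x2)) * \<mu> bot"
      using A(2)[of "B x1" "B x2"] p(1,5,6) bot(1) unfolding swap by simp
    then show "\<mu> (\<phi> (x1, x2)) = \<mu> x1 * (\<mu> x2 / \<mu> bot)"
      using pos[OF bot(1)] by (simp add: field_simps)
  qed
  have dl12: "distributive_lattice L1" "distributive_lattice L2"
    unfolding L1_def L2_def by (rule distributive_sublattice[OF C1], rule distributive_sublattice[OF C2])
  have "splits_as_product L \<mu> f g L1 L2"
    unfolding splits_as_product_def carr
  proof (intro conjI exI[of _ \<phi>] dl12 iso, rule exI[of _ f], rule exI[of _ g], rule exI[of _ \<mu>],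
      rule exI[of _ "\<lambda>x. \<mu> x / \<mu> bot"], intro conjI ballI)
  qed (use coordinates pos bot C1(1) C2(1) in auto)
  then show ?thesis by blast
qed

lemma cov_eq_0_if_splits:
  assumes "splits_as_product L \<mu> f g L1 L2"
  shows "cov (carrier L) \<mu> f g = 0"
proof -
  obtain \<phi> f' g' \<mu>1 \<mu>2 where iso: "lattice_isomorphism (direct_product L1 L2) L \<phi>"
    and vals: "\<And>x1 x2. x1 \<in> carrier L1 \<Longrightarrow> x2 \<in> carrier L2 \<Longrightarrow>
      f (\<phi> (x1, x2)) = f' x1 \<and> g (\<phi> (x1, x2)) = g' x2 \<and> \<mu> (\<phi> (x1, x2)) = \<mu>1 x1 * \<mu>2 x2"
    using assms unfolding splits_as_product_def by blast
  have bij: "bij_betw \<phi> (carrier L1 \<times> carrier L2) (carrier L)"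
    using iso by (simp add: lattice_isomorphism_def direct_product_def)
  have fubini: "(\<Sum>x\<in>carrier L. h x) = (\<Sum>x\<in>carrier L1. a x) * (\<Sum>x\<in>carrier L2. b x)"
    if "\<And>x1 x2. x1 \<in> carrier L1 \<Longrightarrow> x2 \<in> carrier L2 \<Longrightarrow> h (\<phi> (x1, x2)) = a x1 * b x2"
    for h and a b :: "_ \<Rightarrow> real"
    unfolding sum.reindex_bij_betw[OF bij, symmetric] sum_product sum.cartesian_product
    using that by (intro sum.cong) auto
  have "(\<Sum>x\<in>carrier L. f x * g x * \<mu> x) = (\<Sum>x\<in>carrier L1. f' x * \<mu>1 x) * (\<Sum>x\<in>carrier L2. g' x * \<mu>2 x)"
    "sum \<mu> (carrier L) = sum \<mu>1 (carrier L1) * sum \<mu>2 (carrier L2)"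
    "(\<Sum>x\<in>carrier L. f x * \<mu> x) = (\<Sum>x\<in>carrier L1. f' x * \<mu>1 x) * sum \<mu>2 (carrier L2)"
    "(\<Sum>x\<in>carrier L. g x * \<mu> x) = sum \<mu>1 (carrier L1) * (\<Sum>x\<in>carrier L2. g' x * \<mu>2 x)"
    by (rule fubini; simp add: vals)+
  then show ?thesis by (simp add: cov_def)
qed

theorem theorem1p6:
  fixes L :: "'a gorder" and \<mu> f g :: "'a \<Rightarrow> real"
  assumes "distributive_lattice L"
    and "finite (carrier L)"
    and "\<And>x. x \<in> carrier L \<Longrightarrow> \<mu> x > 0"
    and "log_supermodular L \<mu>"
    and "monotone_on (carrier L) (\<sqsubseteq>\<^bsub>L\<^esub>) (\<le>) f"
    and "monotone_on (carrier L) (\<sqsubseteq>\<^bsub>L\<^esub>) (\<le>) g"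
  shows "((\<Sum>x\<in>carrier L. f x * \<mu> x) * (\<Sum>x\<in>carrier L. g x * \<mu> x)
            = (\<Sum>x\<in>carrier L. f x * g x * \<mu> x) * (\<Sum>x\<in>carrier L. \<mu> x)
          \<longleftrightarrow> (\<exists>(L1 :: 'a gorder) (L2 :: 'a gorder). splits_as_product L \<mu> f g L1 L2))
       \<and> ((\<exists>(L1 :: 'b gorder) (L2 :: 'c gorder). splits_as_product L \<mu> f g L1 L2)
          \<longrightarrow> (\<Sum>x\<in>carrier L. f x * \<mu> x) * (\<Sum>x\<in>carrier L. g x * \<mu> x)
            = (\<Sum>x\<in>carrier L. f x * g x * \<mu> x) * (\<Sum>x\<in>carrier L. \<mu> x))"
proof -
  have equality_iff: "(\<Sum>x\<in>carrier L. f x * \<mu> x) * (\<Sum>x\<in>carrier L. g x * \<mu> x)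
      = (\<Sum>x\<in>carrier L. f x * g x * \<mu> x) * (\<Sum>x\<in>carrier L. \<mu> x) \<longleftrightarrow> cov (carrier L) \<mu> f g = 0"
    by (auto simp: cov_def)
  have "\<exists>(L1 :: 'a gorder) (L2 :: 'a gorder). splits_as_product L \<mu> f g L1 L2"
    if "cov (carrier L) \<mu> f g = 0"
    using assms that by (intro splits_if_cov_eq_0)
  moreover have "cov (carrier L) \<mu> f g = 0"
    if "\<exists>(L1 :: 'a gorder) (L2 :: 'a gorder). splits_as_product L \<mu> f g L1 L2"
    using that cov_eq_0_if_splits by blast
  moreover have "cov (carrier L) \<mu> f g = 0"
    if "\<exists>(L1 :: 'b gorder) (L2 :: 'c gorder). splits_as_product L \<mu> f g L1 L2"
    using that cov_eq_0_if_splits by blast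
  ultimately show ?thesis
    unfolding equality_iff by blast
qed

end
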